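(* Let $G$ be a connected locally finite graph such that for every two disjoint rays $S,Q$ in $G$ there is a constant $c$ and a sequence $P_1,P_2,P_3,\ldots$ of pairwise edge-disjoint $S$–$Q$ paths in $G$ such that $|P_i|\leq c\,i$ for every $i\geq 1$. Then $G$ does not admit a non-constant harmonic function of finite energy; that is, every harmonic function $\phi:V(G)\to\mathbb{R}$ with $W(\phi)<\infty$ is constant.
   Context: Graphs are simple and undirected. A graph is locally finite if every vertex has finite degree. A ray is a 1-way infinite path; two rays are disjoint if they have no vertex in common. An $S$–$Q$ path is a finite path with one endvertex in $V(S)$, the other endvertex in $V(Q)$, and no inner vertex in $V(S)\cup V(Q)$. For a finite path $P$, $|P|$ denotes the number of edges of $P$. A function $\phi:V(G)\to\mathbb{R}$ is harmonic if for every $x\in V(G)$ we have $\phi(x)=\frac{1}{d(x)}\sum_{xy\in E(G)}\phi(y)$, where $d(x)$ is the number of edges incident with $x$. The (Dirichlet) energy of $\phi$ is $W(\phi):=\sum_{uv\in E(G)}(\phi(u)-\phi(v))^2$, the sum being over all (undirected) edges of $G$. *)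

theory Defs
  imports "HOL-Analysis.Analysis"
begin

definition simple_graph :: "'a set \<Rightarrow> 'a set set \<Rightarrow> bool" where
  "simple_graph V E \<longleftrightarrow> (\<forall>e\<in>E. e \<subseteq> V \<and> card e = 2)"

definition incident_edges :: "'a set set \<Rightarrow> 'a \<Rightarrow> 'a set set" where
  "incident_edges E x = {e \<in> E. x \<in> e}"

definition vertex_degree :: "'a set set \<Rightarrow> 'a \<Rightarrow> nat" where
  "vertex_degree E x = card (incident_edges E x)"

definition locally_finite_graph :: "'a set \<Rightarrow> 'a set set \<Rightarrow> bool" where
  "locally_finite_graph V E \<longleftrightarrow> (\<forall>x\<in>V. finite (incident_edges E x))"

text \<open>A finite path is given by the list of its vertices in order; the two orientations of
  a path are represented by a list and its reverse.\<close>

definition graph_path :: "'a set \<Rightarrow> 'a set set \<Rightarrow> 'a list \<Rightarrow> bool" where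
  "graph_path V E p \<longleftrightarrow>
     p \<noteq> [] \<and> set p \<subseteq> V \<and> distinct p \<and> successively (\<lambda>u v. {u, v} \<in> E) p"

definition path_edges :: "'a list \<Rightarrow> 'a set set" where
  "path_edges p = {{p ! i, p ! Suc i} | i. Suc i < length p}"

definition path_size :: "'a list \<Rightarrow> nat" where
  "path_size p = card (path_edges p)"

lemma path_size_eq:
  assumes "distinct p"
  shows "path_size p = length p - 1"
proof -
  have eq: "path_edges p = (\<lambda>i. {p ! i, p ! Suc i}) ` {..<length p - 1}"
    by (auto simp: path_edges_def)
  have "inj_on (\<lambda>i. {p ! i, p ! Suc i}) {..<length p - 1}"
    using assms by (auto simp: inj_on_def doubleton_eq_iff nth_eq_iff_index_eq)
  then show ?thesis
    by (simp add: path_size_def eq card_image)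
qed

definition connected_graph :: "'a set \<Rightarrow> 'a set set \<Rightarrow> bool" where
  "connected_graph V E \<longleftrightarrow>
     (\<forall>u\<in>V. \<forall>v\<in>V. \<exists>p. graph_path V E p \<and> hd p = u \<and> last p = v)"

definition ray :: "'a set \<Rightarrow> 'a set set \<Rightarrow> (nat \<Rightarrow> 'a) \<Rightarrow> bool" where
  "ray V E r \<longleftrightarrow> range r \<subseteq> V \<and> inj r \<and> (\<forall>n. {r n, r (Suc n)} \<in> E)"

text \<open>\<open>A\<close> and \<open>B\<close> are the vertex sets of the two subgraphs being joined. The list is oriented
  from \<open>A\<close> to \<open>B\<close>, and \<open>butlast (tl p)\<close> lists the inner vertices of the path.\<close>

definition path_between :: "'a set \<Rightarrow> 'a set set \<Rightarrow> 'a set \<Rightarrow> 'a set \<Rightarrow> 'a list \<Rightarrow> bool" where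
  "path_between V E A B p \<longleftrightarrow>
     graph_path V E p \<and> hd p \<in> A \<and> last p \<in> B \<and> set (butlast (tl p)) \<inter> (A \<union> B) = {}"

definition graph_harmonic :: "'a set \<Rightarrow> 'a set set \<Rightarrow> ('a \<Rightarrow> real) \<Rightarrow> bool" where
  "graph_harmonic V E \<phi> \<longleftrightarrow>
     (\<forall>x\<in>V. \<phi> x = 1 / real (vertex_degree E x) * (\<Sum>y | {x, y} \<in> E. \<phi> y))"

text \<open>The summand \<open>(\<phi> u - \<phi> v)\<^sup>2\<close> is symmetric in the endvertices, hence a function of the
  undirected edge.\<close>

definition edge_energy :: "('a \<Rightarrow> real) \<Rightarrow> 'a set \<Rightarrow> real" where
  "edge_energy \<phi> e = (THE d. \<exists>u v. e = {u, v} \<and> d = (\<phi> u - \<phi> v)\<^sup>2)"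

lemma edge_energy_doubleton: "edge_energy \<phi> {u, v} = (\<phi> u - \<phi> v)\<^sup>2"
  unfolding edge_energy_def
  by (rule the_equality) (auto simp: doubleton_eq_iff power2_commute)

definition dirichlet_energy :: "'a set set \<Rightarrow> ('a \<Rightarrow> real) \<Rightarrow> ennreal" where
  "dirichlet_energy E \<phi> = (\<Sum>\<^sub>\<infinity>e\<in>E. ennreal (edge_energy \<phi> e))"

end

theory Submission
  imports Defs
begin

text \<open>A non-constant harmonic function \<open>\<phi>\<close> differs at the ends of some edge \<open>xy\<close>, say
  \<open>\<phi> x < \<phi> y\<close>. By harmonicity there is a ray from \<open>x\<close> along which \<open>\<phi>\<close> decreases and a ray from
  \<open>y\<close> along which it increases; these are disjoint, and \<open>\<phi>\<close> changes by at least
  \<open>\<delta> = \<phi> y - \<phi> x\<close> along every path joining them. By Cauchy-Schwarz such a path of length \<open>n\<close>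
  carries energy at least \<open>\<delta>\<^sup>2 / n\<close>, so edge-disjoint paths of lengths at most \<open>c i\<close> give the
  energy a divergent harmonic minorant.\<close>

lemma edge_vertices:
  assumes "simple_graph V E" "{x, y} \<in> E"
  shows "x \<in> V" "y \<in> V" "x \<noteq> y"
  using assms by (fastforce simp: simple_graph_def)+

text \<open>The degree counts incident edges, whereas the mean in \<open>graph_harmonic\<close> runs
  over neighbours; this identifies the two counts.\<close>

lemma bij_betw_neighbours_incident_edges:
  assumes "simple_graph V E"
  shows "bij_betw (\<lambda>y. {x, y}) {y. {x, y} \<in> E} (incident_edges E x)"
proof -
  have "\<exists>y. e = {x, y}" if "e \<in> E" "x \<in> e" for e
  proof -
    from assms that(1) obtain u v where "e = {u, v}"
      unfolding simple_graph_def by (metis card_2_iff)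
    with that(2) show ?thesis by auto
  qed
  then show ?thesis
    by (fastforce simp: bij_betw_def inj_on_def incident_edges_def doubleton_eq_iff)
qed

lemma harmonic_sum_differences_eq_0:
  assumes "simple_graph V E" "locally_finite_graph V E" "graph_harmonic V E \<phi>" "x \<in> V"
  shows "finite {y. {x, y} \<in> E}" "(\<Sum>y | {x, y} \<in> E. \<phi> y - \<phi> x) = 0"
proof -
  note bij = bij_betw_neighbours_incident_edges[OF assms(1), of x]
  show fin: "finite {y. {x, y} \<in> E}"
    using bij_betw_finite[OF bij] assms(2,4) by (simp add: locally_finite_graph_def)
  have deg: "vertex_degree E x = card {y. {x, y} \<in> E}"
    using bij_betw_same_card[OF bij] by (simp add: vertex_degree_def)
  have mean: "\<phi> x = 1 / real (vertex_degree E x) * (\<Sum>y | {x, y} \<in> E. \<phi> y)"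
    using assms(3,4) by (simp add: graph_harmonic_def)
  show "(\<Sum>y | {x, y} \<in> E. \<phi> y - \<phi> x) = 0"
  \<comment> \<open>At an isolated vertex the degree is 0 and cannot be multiplied out, but there
    the sum is empty.\<close>
  proof (cases "{y. {x, y} \<in> E} = {}")
    case False
    then have "card {y. {x, y} \<in> E} \<noteq> 0" using fin by simp
    then have "real (card {y. {x, y} \<in> E}) * \<phi> x = (\<Sum>y | {x, y} \<in> E. \<phi> y)"
      using mean unfolding deg by (simp add: field_simps)
    then show ?thesis by (simp add: sum_subtractf)
  qed simp
qed

text \<open>The differences to the neighbours sum to 0. Were none of them negative, all would
  vanish, including the one at \<open>y\<close>.\<close>

lemma harmonic_smaller_neighbour:
  assumes "simple_graph V E" "locally_finite_graph V E" "graph_harmonic V E \<phi>"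
    and "{x, y} \<in> E" "\<phi> y \<noteq> \<phi> x"
  shows "\<exists>z. {x, z} \<in> E \<and> \<phi> z < \<phi> x"
proof (rule ccontr)
  assume no: "\<not> ?thesis"
  have "x \<in> V" using edge_vertices(1)[OF assms(1,4)] .
  note sum0 = harmonic_sum_differences_eq_0[OF assms(1-3) this]
  have "\<forall>y\<in>{y. {x, y} \<in> E}. \<phi> y - \<phi> x = 0"
    using no sum0 by (subst sum_nonneg_eq_0_iff[symmetric]) (auto simp: not_less)
  with assms(4,5) show False by auto
qed

text \<open>Move repeatedly to a neighbour of smaller value. Strict decrease prevents a vertex from
  recurring, so the walk is a ray.\<close>

lemma harmonic_decreasing_ray:
  assumes "simple_graph V E" "locally_finite_graph V E" "graph_harmonic V E \<phi>"
    and "{x, y} \<in> E" "\<phi> y \<noteq> \<phi> x"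
  obtains r where "ray V E r" "\<And>n. \<phi> (r n) \<le> \<phi> x"
proof -
  \<comment> \<open>The second conjunct of \<open>?P\<close> is what
    \<open>harmonic_smaller_neighbour\<close> requires in order to continue from
    \<open>u\<close>.\<close>
  let ?P = "\<lambda>(n::nat) u. \<phi> u \<le> \<phi> x \<and> (\<exists>v. {u, v} \<in> E \<and> \<phi> v \<noteq> \<phi> u)"
  let ?Q = "\<lambda>(n::nat) u v. {u, v} \<in> E \<and> \<phi> v < \<phi> u"
  have "\<exists>r. \<forall>n. ?P n (r n) \<and> ?Q n (r n) (r (Suc n))"
  proof (rule dependent_nat_choice)
    show "\<exists>u. ?P 0 u" using assms(4,5) by blast
  next
    fix u n assume u: "?P n u"
    then obtain v where v: "{u, v} \<in> E" "\<phi> v < \<phi> u"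
      using harmonic_smaller_neighbour[OF assms(1-3)] by blast
    then have "{v, u} \<in> E" by (simp add: insert_commute)
    \<comment> \<open>The vertex \<open>u\<close> just left serves as the neighbour of
      \<open>v\<close> with a different value.\<close>
    with u v show "\<exists>v. ?P (Suc n) v \<and> ?Q n u v"
      by (intro exI[of _ v]) (auto intro!: exI[of _ u])
  qed
  then obtain r where r: "\<And>n. \<phi> (r n) \<le> \<phi> x" "\<And>n. {r n, r (Suc n)} \<in> E"
      "\<And>n. \<phi> (r (Suc n)) < \<phi> (r n)"
    by blast
  have "- \<phi> (r m) < - \<phi> (r n)" if "m < n" for m n
    by (rule lift_Suc_mono_less[OF _ that]) (use r(3) in simp)
  then have "inj r"
    by (intro linorder_injI) (metis less_irrefl)
  then have "ray V E r"
    using r(2) edge_vertices(1)[OF assms(1)] by (auto simp: ray_def)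
  with r(1) show thesis using that by blast
qed

text \<open>Turns a decreasing ray for \<open>- \<phi>\<close> into an increasing one for
  \<phi>.\<close>

lemma graph_harmonic_uminus:
  "graph_harmonic V E \<phi> \<Longrightarrow> graph_harmonic V E (\<lambda>x. - \<phi> x)"
  by (simp add: graph_harmonic_def sum_negf)

text \<open>If \<phi> agreed across every edge, it would agree at the two ends of any path, by
  induction along the path.\<close>

lemma connected_graph_non_constant_edge:
  fixes \<phi> :: "'a \<Rightarrow> 'b"
  assumes "connected_graph V E" "\<not> \<phi> constant_on V"
  obtains x y where "{x, y} \<in> E" "\<phi> x \<noteq> \<phi> y"
proof -
  obtain u v where uv: "u \<in> V" "v \<in> V" "\<phi> u \<noteq> \<phi> v"
    using assms(2) unfolding constant_on_def by metis
  then obtain p where p: "graph_path V E p" "hd p = u" "last p = v"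
    using assms(1) by (auto simp: connected_graph_def)
  have "p \<noteq> [] \<Longrightarrow> successively (\<lambda>u v. {u, v} \<in> E) p \<Longrightarrow> \<phi> (hd p) \<noteq> \<phi> (last p) \<Longrightarrow>
        \<exists>x y. {x, y} \<in> E \<and> \<phi> x \<noteq> \<phi> y" for p
  proof (induction p rule: induct_list012)
    case (3 u v p)
    show ?case
    proof (cases "\<phi> u = \<phi> v")
      case True
      with 3 show ?thesis by simp
    next
      case False
      with 3 show ?thesis by auto
    qed
  qed simp_all
  from this[of p] have "\<exists>x y. {x, y} \<in> E \<and> \<phi> x \<noteq> \<phi> y"
    using p uv by (simp add: graph_path_def)
  with that show thesis by blast
qed

lemma edge_energy_nonneg:
  assumes "simple_graph V E" "e \<in> E"
  shows "0 \<le> edge_energy \<phi> e"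
proof -
  obtain u v where "e = {u, v}"
    using assms unfolding simple_graph_def by (metis card_2_iff)
  then show ?thesis by (simp add: edge_energy_doubleton)
qed

lemma path_edges_image: "path_edges p = (\<lambda>i. {p ! i, p ! Suc i}) ` {..<length p - 1}"
  by (auto simp: path_edges_def)

lemma finite_path_edges: "finite (path_edges p)"
  by (simp add: path_edges_image)

lemma path_edges_subset:
  assumes "graph_path V E p"
  shows "path_edges p \<subseteq> E"
  using assms by (auto simp: graph_path_def path_edges_def successively_conv_nth)

text \<open>The difference between the ends telescopes along the path; Cauchy-Schwarz against the
  constant 1 then gives the factor \<open>path_size p\<close>.\<close>

lemma path_energy_lower_bound:
  assumes "graph_path V E p"
  shows "(\<phi> (last p) - \<phi> (hd p))\<^sup>2 \<le> (\<Sum>e\<in>path_edges p. edge_energy \<phi> e) * real (path_size p)"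
proof -
  have d: "distinct p" and ne: "p \<noteq> []"
    using assms by (auto simp: graph_path_def)
  let ?n = "length p - 1"
  \<comment> \<open>Distinct vertices make the edges distinct, so a sum over positions equals the
    sum over the edge set.\<close>
  have inj: "inj_on (\<lambda>i. {p ! i, p ! Suc i}) {..<?n}"
    using d by (auto simp: inj_on_def doubleton_eq_iff nth_eq_iff_index_eq)
  have "\<phi> (last p) - \<phi> (hd p) = (\<Sum>i<?n. \<phi> (p ! Suc i) - \<phi> (p ! i))"
    using sum_lessThan_telescope[of "\<lambda>i. \<phi> (p ! i)" ?n] ne by (simp add: last_conv_nth hd_conv_nth)
  then have "(\<phi> (last p) - \<phi> (hd p))\<^sup>2 \<le> (\<Sum>i<?n. (\<phi> (p ! Suc i) - \<phi> (p ! i))\<^sup>2) * real ?n"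
    using sum_squared_le_sum_of_squares[of "\<lambda>i. \<phi> (p ! Suc i) - \<phi> (p ! i)" "{..<?n}"] by simp
  also have "(\<Sum>i<?n. (\<phi> (p ! Suc i) - \<phi> (p ! i))\<^sup>2) = (\<Sum>e\<in>path_edges p. edge_energy \<phi> e)"
    unfolding path_edges_image sum.reindex[OF inj]
    by (simp add: edge_energy_doubleton power2_commute)
  finally show ?thesis using path_size_eq[OF d] by simp
qed

text \<open>With nonnegative summands the infinite sum is the supremum of its finite partial
  sums.\<close>

lemma sum_edge_energy_le_dirichlet_energy:
  assumes "simple_graph V E" "finite F" "F \<subseteq> E"
  shows "ennreal (\<Sum>e\<in>F. edge_energy \<phi> e) \<le> dirichlet_energy E \<phi>"
proof -
  have "ennreal (\<Sum>e\<in>F. edge_energy \<phi> e) = (\<Sum>e\<in>F. ennreal (edge_energy \<phi> e))"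
    using assms edge_energy_nonneg by (intro sum_ennreal[symmetric]) blast
  also have "\<dots> \<le> dirichlet_energy E \<phi>"
    unfolding dirichlet_energy_def using assms(2,3)
    by (subst nonneg_infsum_complete) (auto intro: SUP_upper)
  finally show ?thesis .
qed

lemma dirichlet_energy_infinite:
  fixes \<delta> c :: real
  assumes simple: "simple_graph V E" and "0 < \<delta>"
    and path: "\<And>i. 1 \<le> i \<Longrightarrow> graph_path V E (P i)"
    and diff: "\<And>i. 1 \<le> i \<Longrightarrow> \<delta> \<le> \<phi> (last (P i)) - \<phi> (hd (P i))"
    and disj: "disjoint_family_on (\<lambda>i. path_edges (P i)) {1..}"
    and size: "\<And>i. 1 \<le> i \<Longrightarrow> real (path_size (P i)) \<le> c * real i"
  shows "dirichlet_energy E \<phi> = \<infinity>"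
proof (rule ccontr)
  assume "dirichlet_energy E \<phi> \<noteq> \<infinity>"
  then obtain B where B: "dirichlet_energy E \<phi> = ennreal B" "0 \<le> B"
    by (cases "dirichlet_energy E \<phi>") auto
  define W where "W i = (\<Sum>e\<in>path_edges (P i). edge_energy \<phi> e)" for i
  have path_energy: "\<delta>\<^sup>2 \<le> W i * real (path_size (P i))" if "1 \<le> i" for i
  proof -
    have "\<delta>\<^sup>2 \<le> (\<phi> (last (P i)) - \<phi> (hd (P i)))\<^sup>2"
      using diff[OF that] \<open>0 < \<delta>\<close> by (intro power_mono) auto
    then show ?thesis
      using path_energy_lower_bound[OF path[OF that], of \<phi>] by (simp add: W_def)
  qed
  have W_nonneg: "0 \<le> W i" if "1 \<le> i" for i
    unfolding W_def using path_edges_subset[OF path[OF that]] edge_energy_nonneg[OF simple]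
    by (intro sum_nonneg) blast
  have bound: "\<delta>\<^sup>2 \<le> W i * (c * real i)" if "1 \<le> i" for i
    using path_energy[OF that] mult_left_mono[OF size[OF that] W_nonneg[OF that]] by linarith
  \<comment> \<open>The sign of \<open>c\<close> is not given: it follows from the bound at
    \<open>i = 1\<close>, where \<open>W 1\<close> is nonnegative and the product is
    positive.\<close>
  have "0 < \<delta>\<^sup>2" using \<open>0 < \<delta>\<close> by simp
  also have "\<dots> \<le> W 1 * c" using bound[of 1] by simp
  finally have "0 < W 1 * c" .
  then have "0 < c" using W_nonneg[of 1] by (simp add: zero_less_mult_iff)
  have "\<delta>\<^sup>2 / c * harm n \<le> B" for n
  proof -
    have "\<delta>\<^sup>2 / c * harm n = (\<Sum>i=1..n. \<delta>\<^sup>2 / (c * real i))"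
      by (simp add: harm_def sum_distrib_left divide_simps)
    also have "\<dots> \<le> (\<Sum>i=1..n. W i)"
      using bound \<open>0 < c\<close> by (intro sum_mono) (simp add: divide_le_eq)
    \<comment> \<open>Edge-disjointness enters here: no edge is counted for two different
      paths.\<close>
    also have "\<dots> = (\<Sum>e\<in>(\<Union>i\<in>{1..n}. path_edges (P i)). edge_energy \<phi> e)"
      unfolding W_def using disj
      by (intro sum.UNION_disjoint[symmetric]) (auto simp: finite_path_edges disjoint_family_on_def)
    finally have "ennreal (\<delta>\<^sup>2 / c * harm n) \<le>
        ennreal (\<Sum>e\<in>(\<Union>i\<in>{1..n}. path_edges (P i)). edge_energy \<phi> e)"
      by (rule ennreal_leI)
    also have "\<dots> \<le> ennreal B"
      unfolding B(1)[symmetric]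
    proof (rule sum_edge_energy_le_dirichlet_energy[OF simple])
      show "(\<Union>i\<in>{1..n}. path_edges (P i)) \<subseteq> E"
        by (rule UN_least) (simp add: path_edges_subset[OF path])
    qed (simp add: finite_path_edges)
    finally show ?thesis using B(2) by (simp add: ennreal_le_iff)
  qed
  then have harm_le: "harm n \<le> B * c / \<delta>\<^sup>2" for n
    using \<open>0 < c\<close> \<open>0 < \<delta>\<close> by (simp add: field_simps)
  \<comment> \<open>The harmonic numbers \<open>harm n\<close> are unbounded.\<close>
  obtain n where "B * c / \<delta>\<^sup>2 < (harm n :: real)"
    using harm_at_top unfolding filterlim_at_top_dense eventually_sequentially by blast
  with harm_le show False by (meson not_less)
qed

theorem lemma3p1:
  fixes V :: "'a set" and E :: "'a set set"
  assumes "simple_graph V E"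
    and "connected_graph V E"
    and "locally_finite_graph V E"
    and "\<And>S Q. ray V E S \<Longrightarrow> ray V E Q \<Longrightarrow> range S \<inter> range Q = {} \<Longrightarrow>
           \<exists>(c :: real) (P :: nat \<Rightarrow> 'a list).
             (\<forall>i\<ge>1. path_between V E (range S) (range Q) (P i)) \<and>
             disjoint_family_on (\<lambda>i. path_edges (P i)) {1..} \<and>
             (\<forall>i\<ge>1. real (path_size (P i)) \<le> c * real i)"
  shows "\<forall>\<phi> :: 'a \<Rightarrow> real.
           graph_harmonic V E \<phi> \<and> dirichlet_energy E \<phi> < \<infinity> \<longrightarrow> \<phi> constant_on V"
proof (intro allI impI, elim conjE, rule ccontr)
  fix \<phi> :: "'a \<Rightarrow> real"
  assume harm: "graph_harmonic V E \<phi>" and fin: "dirichlet_energy E \<phi> < \<infinity>"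
    and "\<not> \<phi> constant_on V"
  then obtain u v where "{u, v} \<in> E" "\<phi> u \<noteq> \<phi> v"
    using connected_graph_non_constant_edge[OF assms(2)] by blast
  \<comment> \<open>Name the ends of the edge so that \<open>x\<close> has the smaller
    value.\<close>
  then have "{u, v} \<in> E \<and> \<phi> u < \<phi> v \<or> {v, u} \<in> E \<and> \<phi> v < \<phi> u"
    by (auto simp: insert_commute)
  then obtain x y where xy: "{x, y} \<in> E" "\<phi> x < \<phi> y"
    by blast
  then have yx: "{y, x} \<in> E" by (simp add: insert_commute)
  obtain S where S: "ray V E S" "\<And>n. \<phi> (S n) \<le> \<phi> x"
    using harmonic_decreasing_ray[OF assms(1,3) harm xy(1)] xy(2) by auto
  obtain Q where Q: "ray V E Q" "\<And>n. \<phi> y \<le> \<phi> (Q n)"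
    using harmonic_decreasing_ray[OF assms(1,3) graph_harmonic_uminus[OF harm] yx] xy(2) by auto
  \<comment> \<open>A common vertex would have value at most \<open>\<phi> x\<close> and at least
    \<open>\<phi> y\<close>.\<close>
  have "range S \<inter> range Q = {}"
  proof (rule ccontr)
    assume "range S \<inter> range Q \<noteq> {}"
    then obtain m n where "S m = Q n" by auto
    with S(2)[of m] Q(2)[of n] xy(2) show False by simp
  qed
  from assms(4)[OF S(1) Q(1) this] obtain c :: real and P where
      P: "\<And>i. i \<ge> 1 \<Longrightarrow> path_between V E (range S) (range Q) (P i)"
         "disjoint_family_on (\<lambda>i. path_edges (P i)) {1..}"
         "\<And>i. i \<ge> 1 \<Longrightarrow> real (path_size (P i)) \<le> c * real i"
    by blast
  have "dirichlet_energy E \<phi> = \<infinity>"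
  proof (rule dirichlet_energy_infinite[where \<delta> = "\<phi> y - \<phi> x" and P = P and c = c])
    fix i :: nat assume "1 \<le> i"
    \<comment> \<open>The paths are oriented from \<open>S\<close> to \<open>Q\<close>, so the
      difference has the right sign.\<close>
    from P(1)[OF this] obtain m n where "hd (P i) = S m" "last (P i) = Q n"
      by (auto simp: path_between_def)
    then show "\<phi> y - \<phi> x \<le> \<phi> (last (P i)) - \<phi> (hd (P i))"
      using S(2)[of m] Q(2)[of n] by simp
  qed (use assms(1) xy(2) P in \<open>auto simp: path_between_def\<close>)
  with fin show False by simp
qed

end
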